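(* Let $R$ be one of the chain rings $\mathbb{G}_4=\mathbb{Z}_4[X]/(X^2+X+1)$, $\mathbb{S}_4=\mathbb{F}_4[X]/(X^2)$, $\mathbb{T}_4=\mathbb{F}_4[X;a\mapsto a^2]/(X^2)$. Then there exist projective arcs with parameters $(120,8)$, $(140,9)$ and $(152,10)$ in $\mathrm{PHG}(2,R)$.
   Context: $\mathbb{F}_4[X;a\mapsto a^2]$ denotes the skew polynomial ring with commutation rule $Xa=a^2X$. For a finite chain ring $R$ of length $2$ with residue field $\mathbb{F}_q$, the projective Hjelmslev plane $\mathrm{PHG}(2,R)$ is the incidence structure whose points are the free rank-$1$ submodules of the right module $R_R^3$, whose lines are the free rank-$2$ submodules of $R_R^3$, with incidence given by inclusion. A projective $(k,n)$-arc is a set of $k$ points meeting every line in at most $n$ points. *)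

theory Defs
  imports "HOL-Algebra.Ring"
begin

text \<open>F_4 = {0, 1, w, w^2} with w^2 = w + 1; constructors F0, F1, FW, FW2.\<close>

datatype f4 = F0 | F1 | FW | FW2

fun f4add :: "f4 \<Rightarrow> f4 \<Rightarrow> f4" where
  "f4add F0 y = y"
| "f4add x F0 = x"
| "f4add F1 F1 = F0" | "f4add F1 FW = FW2" | "f4add F1 FW2 = FW"
| "f4add FW F1 = FW2" | "f4add FW FW = F0" | "f4add FW FW2 = F1"
| "f4add FW2 F1 = FW" | "f4add FW2 FW = F1" | "f4add FW2 FW2 = F0"

fun f4mul :: "f4 \<Rightarrow> f4 \<Rightarrow> f4" where
  "f4mul F0 y = F0"
| "f4mul x F0 = F0"
| "f4mul F1 y = y"
| "f4mul x F1 = x"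
| "f4mul FW FW = FW2" | "f4mul FW FW2 = F1"
| "f4mul FW2 FW = F1" | "f4mul FW2 FW2 = FW"

definition f4frob :: "f4 \<Rightarrow> f4" where
  "f4frob a = f4mul a a"

section \<open>The three chain rings of order 16, elements written a + bX\<close>

text \<open>G_4 = Z_4[X]/(X^2+X+1): pairs (a,b) of residues in {0..3}, with X^2 = -X-1.\<close>
definition G4 :: "(int \<times> int) ring" where
  "G4 = \<lparr> carrier = {0..3} \<times> {0..3},
          mult = (\<lambda>(a,b) (c,d). ((a*c - b*d) mod 4, (a*d + b*c - b*d) mod 4)),
          one = (1, 0),
          zero = (0, 0),
          add = (\<lambda>(a,b) (c,d). ((a + c) mod 4, (b + d) mod 4)) \<rparr>"

text \<open>S_4 = F_4[X]/(X^2) (commutative).\<close>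
definition S4 :: "(f4 \<times> f4) ring" where
  "S4 = \<lparr> carrier = UNIV,
          mult = (\<lambda>(a,b) (c,d). (f4mul a c, f4add (f4mul a d) (f4mul b c))),
          one = (F1, F0),
          zero = (F0, F0),
          add = (\<lambda>(a,b) (c,d). (f4add a c, f4add b d)) \<rparr>"

text \<open>T_4 = F_4[X; a \<mapsto> a^2]/(X^2), with X a = a^2 X; hence
  (a + bX)(c + dX) = ac + (ad + b c^2) X.\<close>
definition T4 :: "(f4 \<times> f4) ring" where
  "T4 = \<lparr> carrier = UNIV,
          mult = (\<lambda>(a,b) (c,d). (f4mul a c, f4add (f4mul a d) (f4mul b (f4frob c)))),
          one = (F1, F0),
          zero = (F0, F0),
          add = (\<lambda>(a,b) (c,d). (f4add a c, f4add b d)) \<rparr>"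

definition vadd :: "('a, 'm) ring_scheme \<Rightarrow> 'a \<times> 'a \<times> 'a \<Rightarrow> 'a \<times> 'a \<times> 'a \<Rightarrow> 'a \<times> 'a \<times> 'a" where
  "vadd R = (\<lambda>(x1,x2,x3) (y1,y2,y3). (x1 \<oplus>\<^bsub>R\<^esub> y1, x2 \<oplus>\<^bsub>R\<^esub> y2, x3 \<oplus>\<^bsub>R\<^esub> y3))"

definition vsmul :: "('a, 'm) ring_scheme \<Rightarrow> 'a \<times> 'a \<times> 'a \<Rightarrow> 'a \<Rightarrow> 'a \<times> 'a \<times> 'a" where
  "vsmul R = (\<lambda>(x1,x2,x3) r. (x1 \<otimes>\<^bsub>R\<^esub> r, x2 \<otimes>\<^bsub>R\<^esub> r, x3 \<otimes>\<^bsub>R\<^esub> r))"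

definition vzero :: "('a, 'm) ring_scheme \<Rightarrow> 'a \<times> 'a \<times> 'a" where
  "vzero R = (\<zero>\<^bsub>R\<^esub>, \<zero>\<^bsub>R\<^esub>, \<zero>\<^bsub>R\<^esub>)"

definition vcarrier :: "('a, 'm) ring_scheme \<Rightarrow> ('a \<times> 'a \<times> 'a) set" where
  "vcarrier R = carrier R \<times> carrier R \<times> carrier R"

text \<open>A free rank-1 submodule of R_R^3 is vR for a vector v whose right
  annihilator is zero (v is a basis of vR); a free rank-2 submodule is
  vR + wR for right-linearly independent v, w.\<close>

definition phg_points :: "('a, 'm) ring_scheme \<Rightarrow> ('a \<times> 'a \<times> 'a) set set" where
  "phg_points R =
     {{vsmul R v r | r. r \<in> carrier R} | v.
        v \<in> vcarrier R \<and>
        (\<forall>r \<in> carrier R. vsmul R v r = vzero R \<longrightarrow> r = \<zero>\<^bsub>R\<^esub>)}"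

definition phg_lines :: "('a, 'm) ring_scheme \<Rightarrow> ('a \<times> 'a \<times> 'a) set set" where
  "phg_lines R =
     {{vadd R (vsmul R v r) (vsmul R w s) | r s. r \<in> carrier R \<and> s \<in> carrier R} | v w.
        v \<in> vcarrier R \<and> w \<in> vcarrier R \<and>
        (\<forall>r \<in> carrier R. \<forall>s \<in> carrier R.
           vadd R (vsmul R v r) (vsmul R w s) = vzero R \<longrightarrow> r = \<zero>\<^bsub>R\<^esub> \<and> s = \<zero>\<^bsub>R\<^esub>)}"

definition proj_arc :: "('a, 'm) ring_scheme \<Rightarrow> ('a \<times> 'a \<times> 'a) set set \<Rightarrow> nat \<Rightarrow> nat \<Rightarrow> bool" where
  "proj_arc R K k n \<longleftrightarrow>
     K \<subseteq> phg_points R \<and> card K = k \<and>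
     (\<forall>L \<in> phg_lines R. card {P \<in> K. P \<subseteq> L} \<le> n)"

end

theory Submission
  imports Defs
begin

text \<open>
  Write the elements of each ring as pairs over \<open>F\<^sub>4\<close> (residue class, radical part). The plane has 21
  neighbour classes of 16 points, each class an affine plane \<open>AG(2,4)\<close> in which a line through the
  class cuts out an affine line whose direction depends only on the class of the line.

  Fix the class \<open>E\<close> of \<open>(1,0,0)\<close> and the line class \<open>\<ell>\<close> given by \<open>x = 0\<close>. In each of the 15 classes
  outside \<open>E\<close> and \<open>\<ell>\<close> take 8 points on which an \<open>F\<^sub>2\<close>-linear form (a trace) equals 1, chosen so that
  lines in the direction of \<open>E\<close> meet them in 4, 4, 0, 0 points and all other lines in 2 points.
  A line missing \<open>E\<close> meets this set in at most 8 points. On a line through \<open>E\<close> the three forms involved are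
  scaled to sum to 0, so at most two of them are 1 and again there are at most 8 points.
  This is the (120,8)-arc.

  For the (140,9)-arc, add in each class on \<open>\<ell>\<close> a segment of direction \<open>\<ell>\<close>; other lines gain one point
  each, and the segments come from a hyperoval of the dual plane, so lines in \<open>\<ell>\<close> contain at most
  two of them. For the (152,10)-arc, add in three classes on \<open>\<ell>\<close> 8 points given by trace forms summing
  to 0, and in the other two a parabola, which lines in \<open>\<ell>\<close> meet once and other lines at most twice.
\<close>

section \<open>Lines over chain rings of length two\<close>

locale length_two_chain_ring = ring R for R (structure) +
  assumes one_neq_zero: "\<one> \<noteq> \<zero>"
    and nonunit_mult_nonunit:
      "\<lbrakk>x \<in> carrier R - Units R; y \<in> carrier R - Units R\<rbrakk> \<Longrightarrow> x \<otimes> y = \<zero>"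
    and ex_nonzero_nonunit: "\<exists>t \<in> carrier R - Units R. t \<noteq> \<zero>"
begin

abbreviation rad :: "'a set" where
  "rad \<equiv> carrier R - Units R"

section \<open>The nonunits form a two-sided ideal\<close>

lemma rad_mult_left:
  assumes "x \<in> rad" "r \<in> carrier R"
  shows "r \<otimes> x \<in> rad"
proof (rule ccontr)
  assume "r \<otimes> x \<notin> rad"
  with assms have u: "r \<otimes> x \<in> Units R" by auto
  define i where "i = inv (r \<otimes> x)"
  have i: "i \<in> carrier R" "i \<otimes> (r \<otimes> x) = \<one>" using u by (auto simp: i_def)
  \<comment> \<open>An inverse of \<open>r \<otimes> x\<close> would force x = 0, because x squares
    to zero.\<close>
  have "x = (i \<otimes> (r \<otimes> x)) \<otimes> x" using i assms by simp
  also have "\<dots> = i \<otimes> r \<otimes> (x \<otimes> x)" using i(1) assms by (simp add: m_assoc)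
  also have "\<dots> = \<zero>" using i(1) assms nonunit_mult_nonunit[of x x] by simp
  finally show False using i one_neq_zero assms(2) by simp
qed

lemma rad_mult_right:
  assumes "x \<in> rad" "r \<in> carrier R"
  shows "x \<otimes> r \<in> rad"
proof (rule ccontr)
  assume "x \<otimes> r \<notin> rad"
  with assms have u: "x \<otimes> r \<in> Units R" by auto
  define i where "i = inv (x \<otimes> r)"
  have i: "i \<in> carrier R" "(x \<otimes> r) \<otimes> i = \<one>" using u by (auto simp: i_def)
  have "x = x \<otimes> ((x \<otimes> r) \<otimes> i)" using i assms by simp
  also have "\<dots> = (x \<otimes> x) \<otimes> (r \<otimes> i)" using i(1) assms by (simp add: m_assoc)
  also have "\<dots> = \<zero>" using i(1) assms nonunit_mult_nonunit[of x x] by simp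
  finally show False using i one_neq_zero assms(2) by simp
qed

lemma rad_minus: "x \<in> rad \<Longrightarrow> \<ominus> x \<in> rad"
  using rad_mult_left[of x "\<ominus> \<one>"] by (simp add: l_minus)

text \<open>If x + y were a unit, it would still annihilate every nonunit, so zero would be the only
  nonunit.\<close>

lemma rad_add:
  assumes "x \<in> rad" "y \<in> rad"
  shows "x \<oplus> y \<in> rad"
proof (rule ccontr)
  assume "x \<oplus> y \<notin> rad"
  with assms have u: "x \<oplus> y \<in> Units R" by auto
  define i where "i = inv (x \<oplus> y)"
  have i: "i \<in> carrier R" "i \<otimes> (x \<oplus> y) = \<one>" using u by (auto simp: i_def)
  have "z = \<zero>" if z: "z \<in> rad" for z
  proof -
    have "z = i \<otimes> ((x \<oplus> y) \<otimes> z)" using i z assms by (metis DiffD1 a_closed l_one m_assoc)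
    also have "(x \<oplus> y) \<otimes> z = \<zero>"
      using z assms nonunit_mult_nonunit[of x z] nonunit_mult_nonunit[of y z] by (simp add: l_distr)
    finally show ?thesis using i(1) by simp
  qed
  then show False using ex_nonzero_nonunit by blast
qed

text \<open>Column elimination: w - vc has first entry 0 and second entry the unit \<open>u\<close>.
  Comparing third entries determines b, and then v determines a. Spans are right modules, so the
  coefficients of equations stand on the left.\<close>

lemma equation_from_two_pivots:
  assumes C: "v1 \<in> carrier R" "v2 \<in> carrier R" "v3 \<in> carrier R"
      "w1 \<in> carrier R" "w2 \<in> carrier R" "w3 \<in> carrier R"
    and v1: "v1 \<in> Units R" and w2: "w2 \<ominus> v2 \<otimes> (inv v1 \<otimes> w1) \<in> Units R"
  shows "\<exists>a \<in> carrier R. \<exists>b \<in> carrier R. v3 = a \<otimes> v1 \<oplus> b \<otimes> v2 \<and> w3 = a \<otimes> w1 \<oplus> b \<otimes> w2"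
proof -
  define c where "c = inv v1 \<otimes> w1"
  define u where "u = w2 \<ominus> v2 \<otimes> c"
  define b where "b = (w3 \<ominus> v3 \<otimes> c) \<otimes> inv u"
  define a where "a = (v3 \<ominus> b \<otimes> v2) \<otimes> inv v1"
  have u: "u \<in> Units R" using w2 by (simp add: u_def c_def)
  have cl: "c \<in> carrier R" "u \<in> carrier R" "b \<in> carrier R" "a \<in> carrier R"
    using C v1 u by (auto simp: c_def b_def a_def)
  have av: "a \<otimes> v1 = v3 \<ominus> b \<otimes> v2" using C v1 cl by (simp add: a_def m_assoc)
  have bu: "b \<otimes> u = w3 \<ominus> v3 \<otimes> c" using C u cl by (simp add: b_def m_assoc)
  have vc: "v1 \<otimes> c = w1" using C v1 by (simp add: c_def m_assoc[symmetric])
  have "v3 = a \<otimes> v1 \<oplus> b \<otimes> v2" unfolding av using C cl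
    by (simp add: a_minus_def a_assoc l_neg)
  moreover have "w3 = a \<otimes> w1 \<oplus> b \<otimes> w2"
  proof -
    have w2': "w2 = u \<oplus> v2 \<otimes> c" using C cl by (simp add: u_def a_minus_def a_assoc l_neg)
    have "a \<otimes> w1 = (v3 \<ominus> b \<otimes> v2) \<otimes> c" using C cl by (simp add: vc[symmetric] av[symmetric] m_assoc)
    also have "\<dots> = v3 \<otimes> c \<ominus> b \<otimes> v2 \<otimes> c" using C cl by (simp add: a_minus_def l_distr l_minus)
    finally have "a \<otimes> w1 \<oplus> b \<otimes> w2 = (v3 \<otimes> c \<ominus> b \<otimes> v2 \<otimes> c) \<oplus> ((w3 \<ominus> v3 \<otimes> c) \<oplus> b \<otimes> v2 \<otimes> c)"
      using C cl by (simp add: w2' r_distr bu m_assoc)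
    also have "\<dots> = w3"
    proof -
      \<comment> \<open>With the products as atoms the identity is purely additive, so commutativity
        of multiplication does not enter.\<close>
      define p q where "p = v3 \<otimes> c" and "q = b \<otimes> v2 \<otimes> c"
      have "p \<in> carrier R" "q \<in> carrier R" using C cl by (auto simp: p_def q_def)
      then have "(p \<ominus> q) \<oplus> ((w3 \<ominus> p) \<oplus> q) = w3" using C by algebra
      then show ?thesis by (simp add: p_def q_def)
    qed
    finally show ?thesis by simp
  qed
  ultimately show ?thesis using cl by blast
qed

text \<open>If both remaining entries of w - vc were nonunits, multiplying by a nonzero nonunit t
  would give the forbidden relation v(-ct) + wt = 0.\<close>

lemma equation_from_pivot:
  assumes C: "v1 \<in> carrier R" "v2 \<in> carrier R" "v3 \<in> carrier R"
      "w1 \<in> carrier R" "w2 \<in> carrier R" "w3 \<in> carrier R"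
    and v1: "v1 \<in> Units R"
    and indep: "\<And>r s. \<lbrakk>r \<in> carrier R; s \<in> carrier R; v1 \<otimes> r \<oplus> w1 \<otimes> s = \<zero>;
      v2 \<otimes> r \<oplus> w2 \<otimes> s = \<zero>; v3 \<otimes> r \<oplus> w3 \<otimes> s = \<zero>\<rbrakk> \<Longrightarrow> s = \<zero>"
  shows "(\<exists>a \<in> carrier R. \<exists>b \<in> carrier R. v3 = a \<otimes> v1 \<oplus> b \<otimes> v2 \<and> w3 = a \<otimes> w1 \<oplus> b \<otimes> w2) \<or>
    (\<exists>a \<in> carrier R. \<exists>b \<in> carrier R. v2 = a \<otimes> v1 \<oplus> b \<otimes> v3 \<and> w2 = a \<otimes> w1 \<oplus> b \<otimes> w3)"
proof -
  define c where "c = inv v1 \<otimes> w1"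
  have c: "c \<in> carrier R" using C v1 by (simp add: c_def)
  have "w2 \<ominus> v2 \<otimes> c \<in> Units R \<or> w3 \<ominus> v3 \<otimes> c \<in> Units R"
  proof (rule ccontr)
    assume *: "\<not> ?thesis"
    obtain t where t: "t \<in> rad" "t \<noteq> \<zero>" using ex_nonzero_nonunit by blast
    have eq: "vi \<otimes> (\<ominus> (c \<otimes> t)) \<oplus> wi \<otimes> t = (wi \<ominus> vi \<otimes> c) \<otimes> t"
      if "vi \<in> carrier R" "wi \<in> carrier R" for vi wi
      using that c t by (simp add: a_minus_def l_distr r_minus l_minus m_assoc a_comm)
    have vc: "v1 \<otimes> c = w1" using C v1 by (simp add: c_def m_assoc[symmetric])
    have "t = \<zero>"
      by (rule indep[of "\<ominus> (c \<otimes> t)" t])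
        (use C c t * vc eq nonunit_mult_nonunit in \<open>auto simp: a_minus_def r_neg\<close>)
    with t show False by simp
  qed
  then show ?thesis
  proof
    assume "w2 \<ominus> v2 \<otimes> c \<in> Units R"
    from equation_from_two_pivots[OF C v1 this[unfolded c_def]] show ?thesis ..
  next
    assume "w3 \<ominus> v3 \<otimes> c \<in> Units R"
    from equation_from_two_pivots[OF C(1,3,2,4,6,5) v1 this[unfolded c_def]] show ?thesis ..
  qed
qed

lemma linear_equation_span:
  assumes "v1 \<in> carrier R" "v2 \<in> carrier R" "w1 \<in> carrier R" "w2 \<in> carrier R"
    "a \<in> carrier R" "b \<in> carrier R" "r \<in> carrier R" "s \<in> carrier R"
    "v3 = a \<otimes> v1 \<oplus> b \<otimes> v2" "w3 = a \<otimes> w1 \<oplus> b \<otimes> w2"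
  shows "v3 \<otimes> r \<oplus> w3 \<otimes> s = a \<otimes> (v1 \<otimes> r \<oplus> w1 \<otimes> s) \<oplus> b \<otimes> (v2 \<otimes> r \<oplus> w2 \<otimes> s)"
  using assms by (simp add: l_distr r_distr m_assoc a_ac)

lemma solve_linear_equation:
  assumes "y = a \<otimes> x \<oplus> b \<otimes> z" "b \<in> Units R"
    "a \<in> carrier R" "x \<in> carrier R" "z \<in> carrier R"
  shows "z = (\<ominus> (inv b \<otimes> a)) \<otimes> x \<oplus> inv b \<otimes> y"
proof -
  have "inv b \<otimes> y = inv b \<otimes> a \<otimes> x \<oplus> z"
    using assms Units_closed[of b] by (simp add: r_distr m_assoc[symmetric])
  then show ?thesis
    using assms by (simp add: l_minus r_neg1)
qed

text \<open>Some coordinate of the line is a left combination of the other two. If a coefficient is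
  a unit, the equation is solved for a later coordinate, which leaves these three normal forms.
  Inclusions suffice for upper bounds on intersections.\<close>

lemma phg_line_cases:
  assumes "L \<in> phg_lines R"
  obtains a b where "a \<in> carrier R" "b \<in> carrier R"
      "L \<subseteq> {(x, y, z). z = a \<otimes> x \<oplus> b \<otimes> y}"
    | a b where "a \<in> carrier R" "b \<in> rad" "L \<subseteq> {(x, y, z). y = a \<otimes> x \<oplus> b \<otimes> z}"
    | a b where "a \<in> rad" "b \<in> rad" "L \<subseteq> {(x, y, z). x = a \<otimes> y \<oplus> b \<otimes> z}"
proof -
  from assms obtain v w where
    L': "L = {vadd R (vsmul R v r) (vsmul R w s) | r s. r \<in> carrier R \<and> s \<in> carrier R}"
    and vw: "v \<in> vcarrier R" "w \<in> vcarrier R"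
    and ind: "\<forall>r \<in> carrier R. \<forall>s \<in> carrier R.
        vadd R (vsmul R v r) (vsmul R w s) = vzero R \<longrightarrow> r = \<zero> \<and> s = \<zero>"
    unfolding phg_lines_def by blast
  obtain v1 v2 v3 w1 w2 w3 where vw_def: "v = (v1, v2, v3)" "w = (w1, w2, w3)"
    by (metis prod_cases3)
  note L = L'[unfolded vw_def]
  have C: "v1 \<in> carrier R" "v2 \<in> carrier R" "v3 \<in> carrier R"
      "w1 \<in> carrier R" "w2 \<in> carrier R" "w3 \<in> carrier R"
    using vw by (auto simp: vcarrier_def vw_def)
  have indep: "r = \<zero> \<and> s = \<zero>" if "r \<in> carrier R" "s \<in> carrier R" "v1 \<otimes> r \<oplus> w1 \<otimes> s = \<zero>"
      "v2 \<otimes> r \<oplus> w2 \<otimes> s = \<zero>" "v3 \<otimes> r \<oplus> w3 \<otimes> s = \<zero>" for r s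
    using ind that by (simp add: vadd_def vsmul_def vzero_def vw_def)
  have unit: "v1 \<in> Units R \<or> v2 \<in> Units R \<or> v3 \<in> Units R"
  proof (rule ccontr)
    assume *: "\<not> ?thesis"
    obtain t where t: "t \<in> rad" "t \<noteq> \<zero>" using ex_nonzero_nonunit by blast
    \<comment> \<open>If v had only nonunit entries, vt would vanish for a nonzero nonunit
      t.\<close>
    have "t = \<zero>" using indep[of t \<zero>] * C t nonunit_mult_nonunit by auto
    with t show False by simp
  qed
  define eqn where "eqn x3 y3 x1 y1 x2 y2 \<longleftrightarrow>
    (\<exists>a \<in> carrier R. \<exists>b \<in> carrier R. x3 = a \<otimes> x1 \<oplus> b \<otimes> x2 \<and> y3 = a \<otimes> y1 \<oplus> b \<otimes> y2)"
    for x3 y3 x1 y1 x2 y2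
  have eqn_swap: "eqn x3 y3 x1 y1 x2 y2 \<Longrightarrow> eqn x3 y3 x2 y2 x1 y1"
    if "x1 \<in> carrier R" "x2 \<in> carrier R" "y1 \<in> carrier R" "y2 \<in> carrier R" for x3 y3 x1 y1 x2 y2
    unfolding eqn_def using that by (metis a_comm m_closed)
  have eqns: "eqn v3 w3 v1 w1 v2 w2 \<or> eqn v2 w2 v1 w1 v3 w3 \<or> eqn v1 w1 v2 w2 v3 w3"
    using unit
  proof (elim disjE)
    assume "v1 \<in> Units R"
    from equation_from_pivot[OF C this] indep show ?thesis unfolding eqn_def by blast
  next
    assume "v2 \<in> Units R"
    from equation_from_pivot[OF C(2,1,3,5,4,6) this] indep
    have "eqn v3 w3 v2 w2 v1 w1 \<or> eqn v1 w1 v2 w2 v3 w3" unfolding eqn_def by blast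
    then show ?thesis using eqn_swap C by blast
  next
    assume "v3 \<in> Units R"
    from equation_from_pivot[OF C(3,1,2,6,4,5) this] indep
    have "eqn v2 w2 v3 w3 v1 w1 \<or> eqn v1 w1 v3 w3 v2 w2" unfolding eqn_def by blast
    then show ?thesis using eqn_swap C by blast
  qed
  have LC: "L \<subseteq> carrier R \<times> carrier R \<times> carrier R"
    using C by (auto simp: L vadd_def vsmul_def)
  have E1: "\<exists>a \<in> carrier R. \<exists>b \<in> carrier R. L \<subseteq> {(x, y, z). z = a \<otimes> x \<oplus> b \<otimes> y}"
    if "eqn v3 w3 v1 w1 v2 w2"
    using that C unfolding eqn_def L vadd_def vsmul_def
    by (fastforce intro: linear_equation_span)
  have E2: "\<exists>a \<in> carrier R. \<exists>b \<in> carrier R. L \<subseteq> {(x, y, z). y = a \<otimes> x \<oplus> b \<otimes> z}"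
    if "eqn v2 w2 v1 w1 v3 w3"
    using that C unfolding eqn_def L vadd_def vsmul_def
    by (fastforce intro: linear_equation_span)
  have E3: "\<exists>a \<in> carrier R. \<exists>b \<in> carrier R. L \<subseteq> {(x, y, z). x = a \<otimes> y \<oplus> b \<otimes> z}"
    if "eqn v1 w1 v2 w2 v3 w3"
    using that C unfolding eqn_def L vadd_def vsmul_def
    by (fastforce intro: linear_equation_span)
  from eqns consider
      a b where "a \<in> carrier R" "b \<in> carrier R" "L \<subseteq> {(x, y, z). z = a \<otimes> x \<oplus> b \<otimes> y}"
    | a b where "a \<in> carrier R" "b \<in> carrier R" "L \<subseteq> {(x, y, z). y = a \<otimes> x \<oplus> b \<otimes> z}"
    | a b where "a \<in> carrier R" "b \<in> carrier R" "L \<subseteq> {(x, y, z). x = a \<otimes> y \<oplus> b \<otimes> z}"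
    using E1 E2 E3 by metis
  then show thesis
  proof cases
    case 1
    then show ?thesis by (rule that(1))
  next
    case (2 a b)
    show ?thesis
    proof (cases "b \<in> Units R")
      case True
      have "L \<subseteq> {(x, y, z). z = (\<ominus> (inv b \<otimes> a)) \<otimes> x \<oplus> inv b \<otimes> y}"
        using 2 True LC by (auto intro!: solve_linear_equation)
      then show ?thesis by (rule that(1)[rotated 2]) (use 2 True in auto)
    next
      case False
      then show ?thesis using 2 that(2) by blast
    qed
  next
    case (3 a b)
    show ?thesis
    proof (cases "b \<in> Units R")
      case True
      have "L \<subseteq> {(x, y, z). z = inv b \<otimes> x \<oplus> (\<ominus> (inv b \<otimes> a)) \<otimes> y}"
      proof clarify
        fix x y z assume "(x, y, z) \<in> L"
        then have "z = (\<ominus> (inv b \<otimes> a)) \<otimes> y \<oplus> inv b \<otimes> x" and "x \<in> carrier R" "y \<in> carrier R"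
          using 3 True LC by (auto intro!: solve_linear_equation)
        then show "z = inv b \<otimes> x \<oplus> (\<ominus> (inv b \<otimes> a)) \<otimes> y"
          using 3 True by (simp add: a_comm)
      qed
      then show ?thesis by (rule that(1)[rotated 2]) (use 3 True in auto)
    next
      case b: False
      show ?thesis
      proof (cases "a \<in> Units R")
        case True
        have "L \<subseteq> {(x, y, z). y = inv a \<otimes> x \<oplus> (\<ominus> (inv a \<otimes> b)) \<otimes> z}"
        proof clarify
          fix x y z assume xyz: "(x, y, z) \<in> L"
          then have c: "x \<in> carrier R" "y \<in> carrier R" "z \<in> carrier R" using LC by auto
          have "x = b \<otimes> z \<oplus> a \<otimes> y" using xyz 3 c by (auto simp: a_comm)
          then have "y = (\<ominus> (inv a \<otimes> b)) \<otimes> z \<oplus> inv a \<otimes> x"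
            using 3 True c by (intro solve_linear_equation)
          then show "y = inv a \<otimes> x \<oplus> (\<ominus> (inv a \<otimes> b)) \<otimes> z"
            using 3 True c by (simp add: a_comm)
        qed
        then show ?thesis
          by (rule that(2)[rotated 2]) (use 3 True b rad_minus rad_mult_left in auto)
      next
        case False
        then show ?thesis using 3 b that(3) by blast
      qed
    qed
  qed
qed

end

section \<open>Coordinates over the field with four elements\<close>

text \<open>Makes quantifiers over \<open>f4\<close> executable, so that \<open>code_simp\<close>
  decides them.\<close>

instantiation f4 :: enum
begin
definition "enum_f4 = [F0, F1, FW, FW2]"
definition "enum_all_f4 P \<longleftrightarrow> P F0 \<and> P F1 \<and> P FW \<and> P FW2"
definition "enum_ex_f4 P \<longleftrightarrow> P F0 \<or> P F1 \<or> P FW \<or> P FW2"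

instance
proof
  show "(UNIV :: f4 set) = set enum_class.enum"
    unfolding enum_f4_def using f4.exhaust by (auto simp: set_eq_iff)
  show "distinct (enum_class.enum :: f4 list)"
    by (simp add: enum_f4_def)
  show "enum_class.enum_all P \<longleftrightarrow> Ball UNIV P" for P :: "f4 \<Rightarrow> bool"
    unfolding enum_all_f4_def by (metis (full_types) UNIV_I f4.exhaust)
  show "enum_class.enum_ex P \<longleftrightarrow> Bex UNIV P" for P :: "f4 \<Rightarrow> bool"
    unfolding enum_ex_f4_def by (metis (full_types) UNIV_I f4.exhaust)
qed
end

section \<open>Cardinalities by evaluation\<close>

definition count :: "('a::enum \<Rightarrow> bool) \<Rightarrow> nat" where
  "count P = length (filter P enum_class.enum)"

lemma count_eq_card: "count P = card {x. P x}"
proof -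
  have "count P = card (set (filter P enum_class.enum))"
    unfolding count_def by (intro distinct_card[symmetric] distinct_filter enum_distinct)
  then show ?thesis by (simp add: UNIV_enum[symmetric])
qed

text \<open>f and g will parametrise the two families of normalised vectors on a line.\<close>

lemma card_le_count_add_count:
  assumes "X \<subseteq> f ` {x. P x} \<union> g ` {x. Q x}" "count P + count Q \<le> d"
  shows "card X \<le> d"
proof -
  have "card X \<le> card (f ` {x. P x} \<union> g ` {x. Q x})"
    using assms(1) by (intro card_mono) auto
  also have "\<dots> \<le> card (f ` {x. P x}) + card (g ` {x. Q x})"
    by (rule card_Un_le)
  also have "\<dots> \<le> count P + count Q"
    unfolding count_eq_card by (intro add_mono card_image_le) auto
  finally show ?thesis using assms(2) by simp
qed

text \<open>Writing ring elements as \<open>a + bX\<close>, the twist \<open>t\<close> is the automorphism with \<open>Xa = t(a)X\<close>.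
  The carry \<open>k\<close> accounts for Teichmueller representatives not being closed under addition.\<close>
fun chain_add :: "(f4 \<Rightarrow> f4 \<Rightarrow> f4) \<Rightarrow> f4 \<times> f4 \<Rightarrow> f4 \<times> f4 \<Rightarrow> f4 \<times> f4" where
  "chain_add k (a, b) (c, d) = (f4add a c, f4add (f4add b d) (k a c))"

fun chain_mult :: "(f4 \<Rightarrow> f4) \<Rightarrow> f4 \<times> f4 \<Rightarrow> f4 \<times> f4 \<Rightarrow> f4 \<times> f4" where
  "chain_mult t (a, b) (c, d) = (f4mul a c, f4add (f4mul a d) (f4mul b (t c)))"

lemma chain_mult_inverse:
  assumes "t = id \<or> t = f4frob" "a \<noteq> F0"
  shows "\<exists>c d. chain_mult t (a, b) (c, d) = (F1, F0) \<and> chain_mult t (c, d) (a, b) = (F1, F0)"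
proof -
  have "\<forall>a b. a \<noteq> F0 \<longrightarrow> (\<exists>c d. chain_mult id (a, b) (c, d) = (F1, F0) \<and>
      chain_mult id (c, d) (a, b) = (F1, F0))"
    by code_simp
  moreover have "\<forall>a b. a \<noteq> F0 \<longrightarrow> (\<exists>c d. chain_mult f4frob (a, b) (c, d) = (F1, F0) \<and>
      chain_mult f4frob (c, d) (a, b) = (F1, F0))"
    by code_simp
  ultimately show ?thesis using assms by blast
qed

text \<open>An isomorphism from a computable model, which turns incidence in the plane over R into
  finite checks over \<open>f4\<close>.\<close>

locale f4_coordinates = ring R for R (structure) +
  fixes h :: "f4 \<times> f4 \<Rightarrow> 'a" and \<kappa> :: "f4 \<Rightarrow> f4 \<Rightarrow> f4" and \<tau> :: "f4 \<Rightarrow> f4"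
  assumes bij_h: "bij_betw h UNIV (carrier R)"
    and h_add: "h (chain_add \<kappa> x y) = h x \<oplus> h y"
    and h_mult: "h (chain_mult \<tau> x y) = h x \<otimes> h y"
    and h_one: "h (F1, F0) = \<one>"
    and h_zero: "h (F0, F0) = \<zero>"
    and \<tau>: "\<tau> = id \<or> \<tau> = f4frob"
begin

lemma h_carrier [simp]: "h x \<in> carrier R"
  using bij_h by (auto simp: bij_betw_def)

lemma h_eq_iff: "h x = h y \<longleftrightarrow> x = y"
  using bij_betw_imp_inj_on[OF bij_h] by (simp add: inj_eq)

lemma h_surj:
  assumes "x \<in> carrier R"
  obtains a b where "x = h (a, b)"
proof -
  from assms have "x \<in> range h" using bij_h by (simp add: bij_betw_def)
  then obtain p where "x = h p" ..
  then show ?thesis using that by (cases p) simp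
qed

lemma h_Units: "h (a, b) \<in> Units R \<longleftrightarrow> a \<noteq> F0"
proof
  assume "h (a, b) \<in> Units R"
  then obtain y where y: "y \<in> carrier R" "h (a, b) \<otimes> y = \<one>" by (auto simp: Units_def)
  then obtain c d where "y = h (c, d)" by (elim h_surj)
  then have "chain_mult \<tau> (a, b) (c, d) = (F1, F0)"
    using y(2) by (simp only: h_mult[symmetric] h_one[symmetric] h_eq_iff)
  then show "a \<noteq> F0" by auto
next
  assume "a \<noteq> F0"
  then obtain c d where
    "chain_mult \<tau> (a, b) (c, d) = (F1, F0)" "chain_mult \<tau> (c, d) (a, b) = (F1, F0)"
    using chain_mult_inverse[OF \<tau>] by fast
  then have "h (a, b) \<otimes> h (c, d) = \<one>" "h (c, d) \<otimes> h (a, b) = \<one>"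
    by (simp_all only: h_mult[symmetric] h_one)
  then show "h (a, b) \<in> Units R" 
    unfolding Units_def by (intro CollectI conjI bexI[of _ "h (c, d)"]) simp_all
qed

end

sublocale f4_coordinates \<subseteq> length_two_chain_ring R
proof
  show "\<one> \<noteq> \<zero>"
    using h_eq_iff[of "(F1, F0)" "(F0, F0)"] by (simp add: h_one h_zero)
  show "x \<otimes> y = \<zero>" if xy: "x \<in> carrier R - Units R" "y \<in> carrier R - Units R" for x y
  proof -
    obtain a b where "x = h (a, b)" using xy by (blast elim: h_surj)
    moreover obtain c d where "y = h (c, d)" using xy by (blast elim: h_surj)
    moreover from calculation have "a = F0" "c = F0" using xy h_Units by auto
    moreover have "\<tau> F0 = F0" using \<tau> by (auto simp: f4frob_def)
    ultimately show ?thesis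
      by (cases b) (simp_all add: h_mult[symmetric] h_zero)
  qed
  have "h (F0, F1) \<in> carrier R - Units R" "h (F0, F1) \<noteq> \<zero>"
    using h_Units h_eq_iff[of "(F0, F1)" "(F0, F0)"] by (simp_all add: h_zero)
  then show "\<exists>t \<in> carrier R - Units R. t \<noteq> \<zero>" by blast
qed

text \<open>\<open>A\<close>, \<open>B\<close>, \<open>C\<close> select normalised vectors of the
  shapes (1, y, z), (n, 1, z), (n, m, 1); a radical entry is given by its second coordinate
  alone.\<close>

definition num_points ::
    "(f4 \<times> f4 \<Rightarrow> f4 \<times> f4 \<Rightarrow> bool) \<Rightarrow> (f4 \<Rightarrow> f4 \<times> f4 \<Rightarrow> bool) \<Rightarrow> (f4 \<Rightarrow> f4 \<Rightarrow> bool) \<Rightarrow> nat"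
  where "num_points A B C = count (\<lambda>(y, z). A y z) + count (\<lambda>(n, z). B n z) + count (\<lambda>(n, m). C n m)"

text \<open>The three clauses run over the lines \<open>z = ax + by\<close>, \<open>y = ax + bz\<close> with \<open>b\<close> in the radical,
  and \<open>x = ay + bz\<close> with \<open>a, b\<close> in the radical. Each such line has 16 + 4 normalised vectors, and
  a solution in the radical has first coordinate \<open>F0\<close>, whence the \<open>snd\<close>.\<close>
definition line_bound ::
    "(f4 \<Rightarrow> f4 \<Rightarrow> f4) \<Rightarrow> (f4 \<Rightarrow> f4) \<Rightarrow> (f4 \<times> f4 \<Rightarrow> f4 \<times> f4 \<Rightarrow> bool) \<Rightarrow>
      (f4 \<Rightarrow> f4 \<times> f4 \<Rightarrow> bool) \<Rightarrow> (f4 \<Rightarrow> f4 \<Rightarrow> bool) \<Rightarrow> nat \<Rightarrow> bool"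
  where "line_bound k t A B C d \<longleftrightarrow>
    (\<forall>a b. count (\<lambda>y. A y (chain_add k a (chain_mult t b y))) +
      count (\<lambda>n. B n (chain_add k (chain_mult t a (F0, n)) b)) \<le> d) \<and>
    (\<forall>a b. count (\<lambda>z. A (chain_add k a (chain_mult t (F0, b) z)) z) +
      count (\<lambda>n. C n (snd (chain_add k (chain_mult t a (F0, n)) (F0, b)))) \<le> d) \<and>
    (\<forall>a b. count (\<lambda>z. B (snd (chain_add k (F0, a) (chain_mult t (F0, b) z))) z) +
      count (\<lambda>m. C b m) \<le> d)"

context f4_coordinates
begin

lemma h_rad [simp]: "h (F0, b) \<in> rad"
  by (simp add: h_Units)

lemma rad_surj:
  assumes "x \<in> rad"
  obtains b where "x = h (F0, b)"
proof -
  from assms obtain a b where "x = h (a, b)" by (blast elim: h_surj)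
  with assms that show ?thesis by (auto simp: h_Units)
qed

definition point_of :: "'a \<times> 'a \<times> 'a \<Rightarrow> ('a \<times> 'a \<times> 'a) set" where
  "point_of v = {vsmul R v r | r. r \<in> carrier R}"

text \<open>Generators scaled from the right so that their first unit entry is one.\<close>

definition normal_vectors :: "('a \<times> 'a \<times> 'a) set" where
  "normal_vectors = {(\<one>, y, z) | y z. y \<in> carrier R \<and> z \<in> carrier R} \<union>
    {(n, \<one>, z) | n z. n \<in> rad \<and> z \<in> carrier R} \<union> {(n, m, \<one>) | n m. n \<in> rad \<and> m \<in> rad}"

lemma vector_mem_point_of: "v \<in> normal_vectors \<Longrightarrow> v \<in> point_of v"
  unfolding point_of_def
  by (rule CollectI, rule exI[of _ \<one>]) (auto simp: normal_vectors_def vsmul_def)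

lemma point_of_normal_vector: "v \<in> normal_vectors \<Longrightarrow> point_of v \<in> phg_points R"
  unfolding phg_points_def point_of_def vcarrier_def normal_vectors_def
  by (rule CollectI, rule exI[of _ v]) (auto simp: vsmul_def vzero_def)

text \<open>Let v = wr. A nonunit r would put all of v into the radical. Hence the first unit
  entries of v and w are in the same place, and there r = 1.\<close>

lemma inj_on_point_of: "inj_on point_of normal_vectors"
proof (rule inj_onI)
  fix v w assume v: "v \<in> normal_vectors" and w: "w \<in> normal_vectors"
    and eq: "point_of v = point_of w"
  from vector_mem_point_of[OF v] eq obtain r where r: "r \<in> carrier R" "v = vsmul R w r"
    by (auto simp: point_of_def)
  obtain v1 v2 v3 w1 w2 w3 where vw: "v = (v1, v2, v3)" "w = (w1, w2, w3)"
    by (metis prod_cases3)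
  have vr: "v1 = w1 \<otimes> r" "v2 = w2 \<otimes> r" "v3 = w3 \<otimes> r"
    using r(2) by (simp_all add: vw vsmul_def)
  have V: "v1 = \<one> \<or> v1 \<in> rad \<and> v2 = \<one> \<or> v1 \<in> rad \<and> v2 \<in> rad \<and> v3 = \<one>"
    using v by (auto simp: normal_vectors_def vw)
  have W: "w1 = \<one> \<or> w1 \<in> rad \<and> w2 = \<one> \<or> w1 \<in> rad \<and> w2 \<in> rad \<and> w3 = \<one>"
    and wc: "w1 \<in> carrier R" "w2 \<in> carrier R" "w3 \<in> carrier R"
    using w by (auto simp: normal_vectors_def vw)
  have w_rad: "w1 \<in> rad \<Longrightarrow> v1 \<in> rad" "w2 \<in> rad \<Longrightarrow> v2 \<in> rad"
    unfolding vr using rad_mult_right r(1) by simp_all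
  have r_rad: "v1 \<in> rad \<and> v2 \<in> rad \<and> v3 \<in> rad" if "r \<in> rad"
    unfolding vr by (intro conjI rad_mult_left that wc)
  have w_one: "w1 = \<one> \<Longrightarrow> v1 = r" "w2 = \<one> \<Longrightarrow> v2 = r" "w3 = \<one> \<Longrightarrow> v3 = r"
    using vr r(1) by simp_all
  have one: "\<one> \<notin> rad" by simp
  have "r = \<one>" using W
  proof (elim disjE conjE)
    assume "w1 = \<one>"
    then show ?thesis using V r_rad w_one(1) one by auto
  next
    assume "w1 \<in> rad" "w2 = \<one>"
    then show ?thesis using V r_rad w_rad(1) w_one(2) one by auto
  next
    assume "w1 \<in> rad" "w2 \<in> rad" "w3 = \<one>"
    then show ?thesis using V w_rad w_one(3) one by auto
  qed
  then show "v = w" using wc by (simp add: vw vr)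
qed


section \<open>From line intersections to finite counts\<close>

definition normal_points ::
    "(f4 \<times> f4 \<Rightarrow> f4 \<times> f4 \<Rightarrow> bool) \<Rightarrow> (f4 \<Rightarrow> f4 \<times> f4 \<Rightarrow> bool) \<Rightarrow> (f4 \<Rightarrow> f4 \<Rightarrow> bool) \<Rightarrow>
      ('a \<times> 'a \<times> 'a) set"
  where "normal_points A B C = {(\<one>, h y, h z) | y z. A y z} \<union>
    {(h (F0, n), \<one>, h z) | n z. B n z} \<union> {(h (F0, n), h (F0, m), \<one>) | n m. C n m}"

lemma normal_points_subset: "normal_points A B C \<subseteq> normal_vectors"
proof -
  have "h (F0, n) \<in> rad" for n by (rule h_rad)
  then show ?thesis unfolding normal_points_def normal_vectors_def using h_carrier by blast
qed

lemma h_rad_neq_one: "h (F0, n) \<noteq> \<one>"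
  by (simp add: h_one[symmetric] h_eq_iff)

lemma card_normal_points: "card (normal_points A B C) = num_points A B C"
proof -
  let ?a = "\<lambda>(y, z). (\<one>, h y, h z)" and ?b = "\<lambda>(n, z). (h (F0, n), \<one>, h z)"
    and ?c = "\<lambda>(n, m). (h (F0, n), h (F0, m), \<one>)"
  let ?A = "?a ` {(y, z). A y z}" and ?B = "?b ` {(n, z). B n z}" and ?C = "?c ` {(n, m). C n m}"
  have eq: "normal_points A B C = ?A \<union> ?B \<union> ?C"
    unfolding normal_points_def by (auto simp: image_iff)
  have "?A \<inter> ?B = {}" "(?A \<union> ?B) \<inter> ?C = {}"
    using h_rad_neq_one h_rad_neq_one[symmetric] by auto
  then have "card (normal_points A B C) = card ?A + card ?B + card ?C"
    unfolding eq by (subst card_Un_disjoint; simp)+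
  also have "card ?A = card {(y, z). A y z}"
    by (rule card_image) (auto simp: inj_on_def h_eq_iff)
  also have "card ?B = card {(n, z). B n z}"
    by (rule card_image) (auto simp: inj_on_def h_eq_iff)
  also have "card ?C = card {(n, m). C n m}"
    by (rule card_image) (auto simp: inj_on_def h_eq_iff)
  finally show ?thesis by (simp add: num_points_def count_eq_card)
qed

text \<open>Each of the three normal forms of a line admits only two of the three shapes of
  normalised vectors, and on each shape one free parameter remains; \<open>line_bound\<close> counts
  its admissible values.\<close>

lemma proj_arc_normal_points:
  assumes "line_bound \<kappa> \<tau> A B C d"
    and "num_points A B C = k"
  shows "proj_arc R (point_of ` normal_points A B C) k d"
  unfolding proj_arc_def
proof (intro conjI ballI)
  let ?K = "normal_points A B C"
  show "point_of ` ?K \<subseteq> phg_points R"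
    using normal_points_subset point_of_normal_vector by blast
  have "card (point_of ` ?K) = card ?K"
    by (rule card_image) (rule inj_on_subset[OF inj_on_point_of normal_points_subset])
  then show "card (point_of ` ?K) = k"
    using card_normal_points assms(2) by simp
  fix L assume L: "L \<in> phg_lines R"
  have fin: "finite ?K"
  proof -
    have "finite (carrier R)" using bij_betw_finite[OF bij_h] by simp
    then have "finite (carrier R \<times> carrier R \<times> carrier R)" by simp
    moreover have "?K \<subseteq> carrier R \<times> carrier R \<times> carrier R"
      by (auto simp: normal_points_def)
    ultimately show ?thesis by (rule rev_finite_subset)
  qed
  have card_le: "card {P \<in> point_of ` ?K. P \<subseteq> L} \<le> d" if E: "L \<subseteq> E" "card (?K \<inter> E) \<le> d" for E
  proof -
    have "{P \<in> point_of ` ?K. P \<subseteq> L} \<subseteq> point_of ` (?K \<inter> E)"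
    proof
      fix P assume "P \<in> {P \<in> point_of ` ?K. P \<subseteq> L}"
      then obtain v where v: "v \<in> ?K" "P = point_of v" "point_of v \<subseteq> L" by auto
      then have "v \<in> L" using vector_mem_point_of normal_points_subset by blast
      then show "P \<in> point_of ` (?K \<inter> E)" using v E(1) by blast
    qed
    then have "card {P \<in> point_of ` ?K. P \<subseteq> L} \<le> card (point_of ` (?K \<inter> E))"
      using fin by (intro card_mono) auto
    also have "\<dots> \<le> card (?K \<inter> E)" using fin by (intro card_image_le) auto
    finally show ?thesis using E(2) by simp
  qed
  \<comment> \<open>Rules out the third shape: there the entry 1 would be a sum of two radical
    elements.\<close>
  have rad_combination: "a \<otimes> x \<oplus> b \<otimes> y \<noteq> \<one>"
    if "a \<in> carrier R" "b \<in> carrier R" "x \<in> carrier R" "y \<in> carrier R"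
      "a \<in> rad \<or> x \<in> rad" "b \<in> rad \<or> y \<in> rad" for a b x y
  proof -
    have "a \<otimes> x \<in> rad" "b \<otimes> y \<in> rad"
      using that rad_mult_left rad_mult_right by blast+
    then have "a \<otimes> x \<oplus> b \<otimes> y \<in> rad" by (rule rad_add)
    then show ?thesis by (metis DiffD2 Units_one_closed)
  qed
  from L show "card {P \<in> point_of ` ?K. P \<subseteq> L} \<le> d"
  proof (cases rule: phg_line_cases)
    case (1 a' b')
    obtain a where a: "a' = h a" using 1(1) by (blast elim: h_surj)
    obtain b where b: "b' = h b" using 1(2) by (blast elim: h_surj)
    let ?E = "{(x, y, z). z = h a \<otimes> x \<oplus> h b \<otimes> y}"
    let ?P = "\<lambda>y. A y (chain_add \<kappa> a (chain_mult \<tau> b y))"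
    let ?Q = "\<lambda>n. B n (chain_add \<kappa> (chain_mult \<tau> a (F0, n)) b)"
    have "?K \<inter> ?E \<subseteq> (\<lambda>y. (\<one>, h y, h a \<oplus> h b \<otimes> h y)) ` {y. ?P y} \<union>
      (\<lambda>n. (h (F0, n), \<one>, h a \<otimes> h (F0, n) \<oplus> h b)) ` {n. ?Q n}"
    proof
      fix v assume v: "v \<in> ?K \<inter> ?E"
      then consider y z where "A y z" "v = (\<one>, h y, h z)" "h z = h a \<oplus> h b \<otimes> h y"
        | n z where "B n z" "v = (h (F0, n), \<one>, h z)" "h z = h a \<otimes> h (F0, n) \<oplus> h b"
        | n m where "h a \<otimes> h (F0, n) \<oplus> h b \<otimes> h (F0, m) = \<one>"
        by (auto simp: normal_points_def)
      then show "v \<in> (\<lambda>y. (\<one>, h y, h a \<oplus> h b \<otimes> h y)) ` {y. ?P y} \<union>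
        (\<lambda>n. (h (F0, n), \<one>, h a \<otimes> h (F0, n) \<oplus> h b)) ` {n. ?Q n}"
      proof cases
        case (1 y z)
        then have "z = chain_add \<kappa> a (chain_mult \<tau> b y)"
          by (simp add: h_mult[symmetric] h_add[symmetric] h_eq_iff)
        with 1 show ?thesis by auto
      next
        case (2 n z)
        then have "z = chain_add \<kappa> (chain_mult \<tau> a (F0, n)) b"
          by (simp add: h_mult[symmetric] h_add[symmetric] h_eq_iff)
        with 2 show ?thesis by auto
      next
        case (3 n m)
        then show ?thesis using rad_combination h_rad h_carrier by blast
      qed
    qed
    moreover have "count ?P + count ?Q \<le> d"
      using assms(1) unfolding line_bound_def by blast
    ultimately have "card (?K \<inter> ?E) \<le> d" by (rule card_le_count_add_count)
    with 1(3) show ?thesis unfolding a b by (rule card_le)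
  next
    case (2 a' b')
    obtain a where a: "a' = h a" using 2(1) by (blast elim: h_surj)
    obtain b where b: "b' = h (F0, b)" using 2(2) by (rule rad_surj)
    let ?E = "{(x, y, z). y = h a \<otimes> x \<oplus> h (F0, b) \<otimes> z}"
    let ?P = "\<lambda>z. A (chain_add \<kappa> a (chain_mult \<tau> (F0, b) z)) z"
    let ?Q = "\<lambda>n. C n (snd (chain_add \<kappa> (chain_mult \<tau> a (F0, n)) (F0, b)))"
    have "?K \<inter> ?E \<subseteq> (\<lambda>z. (\<one>, h a \<oplus> h (F0, b) \<otimes> h z, h z)) ` {z. ?P z} \<union>
      (\<lambda>n. (h (F0, n), h a \<otimes> h (F0, n) \<oplus> h (F0, b), \<one>)) ` {n. ?Q n}"
    proof
      fix v assume v: "v \<in> ?K \<inter> ?E"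
      then consider y z where "A y z" "v = (\<one>, h y, h z)" "h y = h a \<oplus> h (F0, b) \<otimes> h z"
        | n z where "h a \<otimes> h (F0, n) \<oplus> h (F0, b) \<otimes> h z = \<one>"
        | n m where "C n m" "v = (h (F0, n), h (F0, m), \<one>)"
            "h (F0, m) = h a \<otimes> h (F0, n) \<oplus> h (F0, b)"
        by (auto simp: normal_points_def)
      then show "v \<in> (\<lambda>z. (\<one>, h a \<oplus> h (F0, b) \<otimes> h z, h z)) ` {z. ?P z} \<union>
        (\<lambda>n. (h (F0, n), h a \<otimes> h (F0, n) \<oplus> h (F0, b), \<one>)) ` {n. ?Q n}"
      proof cases
        case (1 y z)
        then have "y = chain_add \<kappa> a (chain_mult \<tau> (F0, b) z)"
          by (simp only: h_mult[symmetric] h_add[symmetric] h_eq_iff)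
        with 1 show ?thesis by auto
      next
        case (2 n z)
        then show ?thesis using rad_combination h_rad h_carrier by blast
      next
        case (3 n m)
        then have "(F0, m) = chain_add \<kappa> (chain_mult \<tau> a (F0, n)) (F0, b)"
          by (simp only: h_mult[symmetric] h_add[symmetric] h_eq_iff)
        then have "m = snd (chain_add \<kappa> (chain_mult \<tau> a (F0, n)) (F0, b))"
          by (metis snd_conv)
        with 3 have "?Q n" by simp
        with 3 show ?thesis by auto
      qed
    qed
    moreover have "count ?P + count ?Q \<le> d"
      using assms(1) unfolding line_bound_def by blast
    ultimately have "card (?K \<inter> ?E) \<le> d" by (rule card_le_count_add_count)
    with 2(3) show ?thesis unfolding a b by (rule card_le)
  next
    case (3 a' b')
    obtain a where a: "a' = h (F0, a)" using 3(1) by (rule rad_surj)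
    obtain b where b: "b' = h (F0, b)" using 3(2) by (rule rad_surj)
    let ?E = "{(x, y, z). x = h (F0, a) \<otimes> y \<oplus> h (F0, b) \<otimes> z}"
    let ?P = "\<lambda>z. B (snd (chain_add \<kappa> (F0, a) (chain_mult \<tau> (F0, b) z))) z"
    let ?Q = "\<lambda>m. C b m"
    have "?K \<inter> ?E \<subseteq> (\<lambda>z. (h (F0, a) \<oplus> h (F0, b) \<otimes> h z, \<one>, h z)) ` {z. ?P z} \<union>
      (\<lambda>m. (h (F0, b), h (F0, m), \<one>)) ` {m. ?Q m}"
    proof
      fix v assume v: "v \<in> ?K \<inter> ?E"
      then consider y z where "h (F0, a) \<otimes> h y \<oplus> h (F0, b) \<otimes> h z = \<one>"
        | n z where "B n z" "v = (h (F0, n), \<one>, h z)" "h (F0, n) = h (F0, a) \<oplus> h (F0, b) \<otimes> h z"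
        | n m where "C n m" "v = (h (F0, n), h (F0, m), \<one>)"
            "h (F0, n) = h (F0, a) \<otimes> h (F0, m) \<oplus> h (F0, b)"
        by (auto simp: normal_points_def)
      then show "v \<in> (\<lambda>z. (h (F0, a) \<oplus> h (F0, b) \<otimes> h z, \<one>, h z)) ` {z. ?P z} \<union>
        (\<lambda>m. (h (F0, b), h (F0, m), \<one>)) ` {m. ?Q m}"
      proof cases
        case (1 y z)
        then show ?thesis using rad_combination h_rad h_carrier by blast
      next
        case (2 n z)
        then have "(F0, n) = chain_add \<kappa> (F0, a) (chain_mult \<tau> (F0, b) z)"
          by (simp only: h_mult[symmetric] h_add[symmetric] h_eq_iff)
        then have "n = snd (chain_add \<kappa> (F0, a) (chain_mult \<tau> (F0, b) z))"
          by (metis snd_conv)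
        with 2 have "?P z" by simp
        with 2 show ?thesis by auto
      next
        case (3 n m)
        \<comment> \<open>The other summand is a product of two radical elements, hence
          zero.\<close>
        have "h (F0, n) = h (F0, b)"
          unfolding 3(3) using nonunit_mult_nonunit[OF h_rad h_rad] by simp
        then have "n = b" by (simp add: h_eq_iff)
        with 3 show ?thesis by auto
      qed
    qed
    moreover have "count ?P + count ?Q \<le> d"
      using assms(1) unfolding line_bound_def by blast
    ultimately have "card (?K \<inter> ?E) \<le> d" by (rule card_le_count_add_count)
    with 3(3) show ?thesis unfolding a b by (rule card_le)
  qed
qed

end

section \<open>The three rings\<close>

lemma f4add_comm: "f4add x y = f4add y x"
  by (cases x; cases y; simp)

lemma f4add_assoc: "f4add (f4add x y) z = f4add x (f4add y z)"
  by (cases x; cases y; cases z; simp)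

lemma f4add_left_comm: "f4add x (f4add y z) = f4add y (f4add x z)"
  by (metis f4add_comm f4add_assoc)

lemma f4add_F0: "f4add x F0 = x"
  by (cases x; simp)

lemma f4add_self: "f4add x x = F0"
  by (cases x; simp)

lemma f4mul_comm: "f4mul x y = f4mul y x"
  by (cases x; cases y; simp)

lemma f4mul_assoc: "f4mul (f4mul x y) z = f4mul x (f4mul y z)"
  by (cases x; cases y; cases z; simp)

lemma f4mul_left_comm: "f4mul x (f4mul y z) = f4mul y (f4mul x z)"
  by (metis f4mul_comm f4mul_assoc)

lemma f4mul_F0: "f4mul x F0 = F0"
  by (cases x; simp)

lemma f4mul_F1: "f4mul x F1 = x" "f4mul F1 x = x"
  by (cases x; simp)+

lemma f4mul_add: "f4mul x (f4add y z) = f4add (f4mul x y) (f4mul x z)"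
  by (cases x; cases y; cases z; simp)

lemmas f4_simps = f4add_comm f4add_assoc f4add_left_comm f4add_F0 f4add_self
  f4mul_comm f4mul_assoc f4mul_left_comm f4mul_F0 f4mul_F1 f4mul_add

lemma f4frob_simps:
  "f4frob (f4add x y) = f4add (f4frob x) (f4frob y)"
  "f4frob (f4mul x y) = f4mul (f4frob x) (f4frob y)"
  "f4frob F0 = F0" "f4frob F1 = F1"
  unfolding f4frob_def by (cases x; cases y; simp)+

lemma ring_S4: "ring S4"
proof (intro ringI abelian_groupI monoidI)
  show "\<exists>y \<in> carrier S4. y \<oplus>\<^bsub>S4\<^esub> x = \<zero>\<^bsub>S4\<^esub>" for x
    \<comment> \<open>In characteristic 2 every element is its own negative.\<close>
    by (cases x, rule bexI[of _ x]) (auto simp: S4_def f4add_self)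
qed (auto simp: S4_def f4_simps)

lemma ring_T4: "ring T4"
proof (intro ringI abelian_groupI monoidI)
  show "\<exists>y \<in> carrier T4. y \<oplus>\<^bsub>T4\<^esub> x = \<zero>\<^bsub>T4\<^esub>" for x
    by (cases x, rule bexI[of _ x]) (auto simp: T4_def f4add_self)
qed (auto simp: T4_def f4_simps f4frob_simps)

text \<open>Strips the inner reductions from nested products in \<open>G4\<close>, so that the ring
  laws become integer identities.\<close>

lemma G4_mult_mod:
  fixes a b c d k :: int
  shows "((a mod k) * c - (b mod k) * d) mod k = (a * c - b * d) mod k"
    and "(a * (c mod k) - b * (d mod k)) mod k = (a * c - b * d) mod k"
    and "((a mod k) * d + (b mod k) * c - (b mod k) * d) mod k = (a * d + b * c - b * d) mod k"
    and "(a * (d mod k) + b * (c mod k) - b * (d mod k)) mod k = (a * d + b * c - b * d) mod k"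
  by (intro mod_diff_cong mod_add_cong; simp add: mod_simps)+

lemma ring_G4: "ring G4"
proof (intro ringI abelian_groupI monoidI)
  show "\<exists>y \<in> carrier G4. y \<oplus>\<^bsub>G4\<^esub> x = \<zero>\<^bsub>G4\<^esub>" for x
    by (rule bexI[of _ "((- fst x) mod 4, (- snd x) mod 4)"])
      (auto simp: G4_def mod_simps split: prod.splits)
qed (auto simp: G4_def mod_simps G4_mult_mod, simp_all add: algebra_simps)

text \<open>Zero and the cube roots of unity 1, X and X^2 = -X - 1 = 3 + 3X: multiplicatively closed
  lifts of the residue field.\<close>

fun teichmueller :: "f4 \<Rightarrow> int \<times> int" where
  "teichmueller F0 = (0, 0)"
| "teichmueller F1 = (1, 0)"
| "teichmueller FW = (0, 1)"
| "teichmueller FW2 = (3, 3)"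

text \<open>The expansion T(a) + 2T(b). The radical is generated by 2, which takes the part of X in
  a + bX; as 2 is central, the twist is \<open>id\<close>.\<close>

fun G4_of :: "f4 \<times> f4 \<Rightarrow> int \<times> int" where
  "G4_of (a, b) =
    ((fst (teichmueller a) + 2 * fst (teichmueller b)) mod 4,
     (snd (teichmueller a) + 2 * snd (teichmueller b)) mod 4)"

text \<open>For \<open>S4\<close> and \<open>T4\<close>, where the constants form a
  subfield.\<close>

definition no_carry :: "f4 \<Rightarrow> f4 \<Rightarrow> f4" where
  "no_carry a b = F0"

text \<open>\<open>T(a) + T(b) = T(a + b) + 2T(c)\<close> with \<open>c\<^sup>2 = ab\<close>, and square roots in
  \<open>F\<^sub>4\<close> are squares.\<close>
definition teichmueller_carry :: "f4 \<Rightarrow> f4 \<Rightarrow> f4" where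
  "teichmueller_carry a b = f4frob (f4mul a b)"

lemma f4_coordinates_S4: "f4_coordinates S4 id no_carry id"
  by (intro f4_coordinates.intro ring_S4 f4_coordinates_axioms.intro)
    (auto simp: S4_def no_carry_def f4_simps)

lemma f4_coordinates_T4: "f4_coordinates T4 id no_carry f4frob"
  by (intro f4_coordinates.intro ring_T4 f4_coordinates_axioms.intro)
    (auto simp: T4_def no_carry_def f4_simps)

lemma f4_coordinates_G4: "f4_coordinates G4 G4_of teichmueller_carry id"
proof (intro f4_coordinates.intro ring_G4 f4_coordinates_axioms.intro)
  have "inj G4_of"
  proof (rule injI)
    have "\<forall>x y. G4_of x = G4_of y \<longrightarrow> x = y" by code_simp
    then show "x = y" if "G4_of x = G4_of y" for x y using that by blast
  qed
  moreover have "range G4_of = carrier G4"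
  proof (rule card_subset_eq)
    show "finite (carrier G4)" by (simp add: G4_def)
    show "range G4_of \<subseteq> carrier G4" by (auto simp: G4_def)
    have "card (range G4_of) = card (UNIV :: (f4 \<times> f4) set)"
      using \<open>inj G4_of\<close> by (rule card_image)
    also have "\<dots> = count (\<lambda>_ :: f4 \<times> f4. True)" by (simp add: count_eq_card)
    also have "\<dots> = 16" by code_simp
    finally show "card (range G4_of) = card (carrier G4)" by (simp add: G4_def)
  qed
  ultimately show "bij_betw G4_of UNIV (carrier G4)" by (simp add: bij_betw_def)
  have "\<forall>x y. G4_of (chain_add teichmueller_carry x y) = G4_of x \<oplus>\<^bsub>G4\<^esub> G4_of y"
    by code_simp
  then show "G4_of (chain_add teichmueller_carry x y) = G4_of x \<oplus>\<^bsub>G4\<^esub> G4_of y" for x y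
    by blast
  have "\<forall>x y. G4_of (chain_mult id x y) = G4_of x \<otimes>\<^bsub>G4\<^esub> G4_of y"
    by code_simp
  then show "G4_of (chain_mult id x y) = G4_of x \<otimes>\<^bsub>G4\<^esub> G4_of y" for x y
    by blast
qed (simp_all add: G4_def)

section \<open>The arcs\<close>

text \<open>True on the elements of trace 1.\<close>
fun f4tr :: "f4 \<Rightarrow> bool" where
  "f4tr F0 = False"
| "f4tr F1 = False"
| "f4tr FW = True"
| "f4tr FW2 = True"

text \<open>The form \<open>t(y\<^sub>0)(z\<^sub>1 + (z\<^sub>0/y\<^sub>0)y\<^sub>1)\<close> vanishes in the direction of \<open>(1,0,0)\<close>. On the line
  \<open>z = ax + by\<close> with \<open>a\<^sub>0 = 0\<close> it equals \<open>t(y\<^sub>0)(a\<^sub>1 + b\<^sub>1t(y\<^sub>0))\<close>, which sums to 0 over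
  \<open>y\<^sub>0 \<noteq> 0\<close>. Here \<open>1/y\<^sub>0 = y\<^sub>0\<^sup>2\<close>.\<close>
fun affine_part :: "(f4 \<Rightarrow> f4) \<Rightarrow> f4 \<times> f4 \<Rightarrow> f4 \<times> f4 \<Rightarrow> bool" where
  "affine_part t (y0, y1) (z0, z1) \<longleftrightarrow>
    (if y0 = F0 then f4tr (f4mul (t z0) y1)
     else f4tr (f4mul (t y0) (f4add z1 (f4mul (f4mul z0 (f4mul y0 y0)) y1))))"

definition no_points :: "'a \<Rightarrow> 'b \<Rightarrow> bool" where
  "no_points n z \<longleftrightarrow> False"

text \<open>A line \<open>x = ay + bz\<close> with \<open>a, b\<close> in the radical contains the segment of the class of
  \<open>(0,1,z\<^sub>0)\<close> iff \<open>s = t(z\<^sub>0)\<close> is a root of \<open>s\<^sup>2 + b\<^sub>1s + a\<^sub>1\<close>, and the segment of the class of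
  \<open>(0,0,1)\<close> iff \<open>b\<^sub>1 = 0\<close>, when the root is unique.\<close>
fun conic_segments :: "(f4 \<Rightarrow> f4) \<Rightarrow> f4 \<Rightarrow> f4 \<times> f4 \<Rightarrow> bool" where
  "conic_segments t n (z0, z1) \<longleftrightarrow> n = f4mul (t z0) (t z0)"

text \<open>The condition s^2 + b1 s + a1 = 0 is a line of the (a1, b1)-plane with coordinates (1,
  s, s^2). These points lie on a conic with nucleus (0, 1, 0), the line b1 = 0 that belongs to this
  segment.\<close>

definition nucleus_segment :: "f4 \<Rightarrow> f4 \<Rightarrow> bool" where
  "nucleus_segment n m \<longleftrightarrow> n = F0"

text \<open>On x = ay + bz with a, b in the radical, n = a1 + b1 t(z0). The arguments t(z0)n sum to
  0 over the nonzero z0, so zero or two of the three traces are 1.\<close>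

fun trace_sets :: "(f4 \<Rightarrow> f4) \<Rightarrow> f4 \<Rightarrow> f4 \<times> f4 \<Rightarrow> bool" where
  "trace_sets t n (z0, z1) \<longleftrightarrow> (if z0 = F0 then z1 = f4mul n n else f4tr (f4mul (t z0) n))"

definition parabola :: "f4 \<Rightarrow> f4 \<Rightarrow> bool" where
  "parabola n m \<longleftrightarrow> m = f4mul n n"

text \<open>Class by class: 120 = 15*8, 140 = 120 + 5*4 and 152 = 120 + 3*8 + 2*4.\<close>

lemma num_points_id:
  shows "num_points (affine_part id) no_points no_points = 120"
    and "num_points (affine_part id) (conic_segments id) nucleus_segment = 140"
    and "num_points (affine_part id) (trace_sets id) parabola = 152"
  by code_simp+

lemma num_points_frob:
  shows "num_points (affine_part f4frob) no_points no_points = 120"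
    and "num_points (affine_part f4frob) (conic_segments f4frob) nucleus_segment = 140"
    and "num_points (affine_part f4frob) (trace_sets f4frob) parabola = 152"
  by code_simp+

text \<open>Evaluation over all 256 + 64 + 16 = 336 normalised line equations.\<close>

lemma line_bound_G4:
  shows "line_bound teichmueller_carry id (affine_part id) no_points no_points 8"
    and "line_bound teichmueller_carry id (affine_part id) (conic_segments id) nucleus_segment 9"
    and "line_bound teichmueller_carry id (affine_part id) (trace_sets id) parabola 10"
  by code_simp+

lemma line_bound_S4:
  shows "line_bound no_carry id (affine_part id) no_points no_points 8"
    and "line_bound no_carry id (affine_part id) (conic_segments id) nucleus_segment 9"
    and "line_bound no_carry id (affine_part id) (trace_sets id) parabola 10"
  by code_simp+

lemma line_bound_T4:
  shows "line_bound no_carry f4frob (affine_part f4frob) no_points no_points 8"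
    and "line_bound no_carry f4frob (affine_part f4frob) (conic_segments f4frob) nucleus_segment 9"
    and "line_bound no_carry f4frob (affine_part f4frob) (trace_sets f4frob) parabola 10"
  by code_simp+

theorem theorem3p6:
  shows "(\<exists>K. proj_arc G4 K 120 8) \<and> (\<exists>K. proj_arc G4 K 140 9) \<and> (\<exists>K. proj_arc G4 K 152 10) \<and>
         (\<exists>K. proj_arc S4 K 120 8) \<and> (\<exists>K. proj_arc S4 K 140 9) \<and> (\<exists>K. proj_arc S4 K 152 10) \<and>
         (\<exists>K. proj_arc T4 K 120 8) \<and> (\<exists>K. proj_arc T4 K 140 9) \<and> (\<exists>K. proj_arc T4 K 152 10)"
proof (intro conjI)
  interpret G4: f4_coordinates G4 G4_of teichmueller_carry id
    by (rule f4_coordinates_G4)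
  interpret S4: f4_coordinates S4 id no_carry id
    by (rule f4_coordinates_S4)
  interpret T4: f4_coordinates T4 id no_carry f4frob
    by (rule f4_coordinates_T4)
  show "\<exists>K. proj_arc G4 K 120 8"
    using G4.proj_arc_normal_points[OF line_bound_G4(1) num_points_id(1)] ..
  show "\<exists>K. proj_arc G4 K 140 9"
    using G4.proj_arc_normal_points[OF line_bound_G4(2) num_points_id(2)] ..
  show "\<exists>K. proj_arc G4 K 152 10"
    using G4.proj_arc_normal_points[OF line_bound_G4(3) num_points_id(3)] ..
  show "\<exists>K. proj_arc S4 K 120 8"
    using S4.proj_arc_normal_points[OF line_bound_S4(1) num_points_id(1)] ..
  show "\<exists>K. proj_arc S4 K 140 9"
    using S4.proj_arc_normal_points[OF line_bound_S4(2) num_points_id(2)] ..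
  show "\<exists>K. proj_arc S4 K 152 10"
    using S4.proj_arc_normal_points[OF line_bound_S4(3) num_points_id(3)] ..
  show "\<exists>K. proj_arc T4 K 120 8"
    using T4.proj_arc_normal_points[OF line_bound_T4(1) num_points_frob(1)] ..
  show "\<exists>K. proj_arc T4 K 140 9"
    using T4.proj_arc_normal_points[OF line_bound_T4(2) num_points_frob(2)] ..
  show "\<exists>K. proj_arc T4 K 152 10"
    using T4.proj_arc_normal_points[OF line_bound_T4(3) num_points_frob(3)] ..
qed

end
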